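(* Let $X$ be a random vector in $\mathbb{R}^n$ with law $\mu$, where the support of $\mu$ is not included in a hyperplane and $\Lambda_\mu$ is essentially smooth. Let $f:\mathbb{R}^n\to\mathbb{R}$ be a measurable function and define, for all $t\in\mathbb{R}$, $$I(t)=\inf\{\Lambda^*_\mu(y): f(y)=t,\ y\in\mathbb{R}^n\}.$$ Let $r>0$. Assume there exists $\kappa\ge r$ such that, denoting $K=\{\Lambda^*_\mu\le\kappa\}$, $$\mathbb{P}(X\notin K)\le e^{-r}.$$ Let $W\subset\mathbb{R}^n$ be a compact convex set such that $$\forall x,y\in K,\quad f(x)-f(y)\le\sup_{\lambda\in W}\langle\lambda,x-y\rangle .$$ Denote by $D$ the ($\ell^2$-)diameter of $K$. Let $\delta>0$ and let $\mathcal{D}_{\delta/2}$ be a $\delta/(2D)$-net of $W$ for the $\ell^2$-norm. Then $$\log\mathbb{P}\big(f(X)\notin V_\delta(\{I\le r\})\big)\le -r+\log|\mathcal{D}_{\delta/2}|+\log\Big(\Big(\frac{\kappa L D}{\delta}\Big)\vee 1\Big)+2,$$ where $L=\sup_{\lambda\in W}\|\lambda\|_{\ell^2}$.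
   Context: The logarithmic Laplace transform of $\mu$ is $\Lambda_\mu(\lambda)=\log\int e^{\langle\lambda,x\rangle}d\mu(x)$, $\lambda\in\mathbb{R}^n$, and its Legendre transform is $\Lambda^*_\mu(x)=\sup_{\lambda\in\mathbb{R}^n}\{\langle\lambda,x\rangle-\Lambda_\mu(\lambda)\}\in[0,+\infty]$. A convex function $\Lambda:\mathbb{R}^n\to\mathbb{R}\cup\{+\infty\}$ with domain $\mathcal{D}_\Lambda=\{\Lambda<+\infty\}$ is essentially smooth if $\mathrm{int}(\mathcal{D}_\Lambda)$ is non-empty, $\Lambda$ is differentiable on $\mathrm{int}(\mathcal{D}_\Lambda)$, and $\Lambda$ is steep: for any sequence $\lambda_k\in\mathrm{int}(\mathcal{D}_\Lambda)$ converging to a point of the boundary of $\mathcal{D}_\Lambda$, $\|\nabla\Lambda(\lambda_k)\|\to+\infty$. For $A\subset\mathbb{R}$, $V_\delta(A)=\{x\in\mathbb{R}:\inf_{y\in A}|x-y|<\delta\}$. An $\varepsilon$-net of a set $A$ is a finite set of points such that every point of $A$ is at distance at most $\varepsilon$ from some point of the set. Conventions: $\inf\emptyset=+\infty$, $a\vee b=\max(a,b)$, $\log 0=-\infty$. *)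

theory Defs
  imports "HOL-Probability.Probability"
begin

text \<open>Logarithm with values in the extended reals: \<open>log 0 = -\<infinity>\<close> and \<open>log \<infinity> = \<infinity>\<close>
  (the library's \<open>ln 0\<close> is \<open>0\<close>). Only used for non-negative arguments.\<close>

definition elog :: "ereal \<Rightarrow> ereal" where
  "elog x = (if x \<le> 0 then -\<infinity> else if x = \<infinity> then \<infinity> else ereal (ln (real_of_ereal x)))"

definition log_laplace :: "'a::euclidean_space measure \<Rightarrow> 'a \<Rightarrow> ereal" where
  "log_laplace \<mu> l = elog (enn2ereal (\<integral>\<^sup>+ x. ennreal (exp (l \<bullet> x)) \<partial>\<mu>))"

definition legendre :: "('a::euclidean_space \<Rightarrow> ereal) \<Rightarrow> 'a \<Rightarrow> ereal" where
  "legendre \<Lambda> x = (SUP l. ereal (l \<bullet> x) - \<Lambda> l)"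

definition msupport :: "'a::topological_space measure \<Rightarrow> 'a set" where
  "msupport \<mu> = {x. \<forall>U. open U \<longrightarrow> x \<in> U \<longrightarrow> emeasure \<mu> U > 0}"

definition hyperplane :: "'a::euclidean_space set \<Rightarrow> bool" where
  "hyperplane H \<longleftrightarrow> (\<exists>a b. a \<noteq> 0 \<and> H = {x. a \<bullet> x = b})"

definition eff_domain :: "('a \<Rightarrow> ereal) \<Rightarrow> 'a set" where
  "eff_domain \<Lambda> = {l. \<Lambda> l < \<infinity>}"

text \<open>Convexity of a function with values in the reals extended by \<open>+\<infinity>\<close>, through its
  epigraph; the library's \<open>convex_on\<close> is for real-valued functions only.\<close>

definition ext_convex :: "('a::real_vector \<Rightarrow> ereal) \<Rightarrow> bool" where
  "ext_convex \<Lambda> \<longleftrightarrow> (\<forall>l. \<Lambda> l \<noteq> -\<infinity>) \<and> convex {(l, t::real). \<Lambda> l \<le> ereal t}"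

text \<open>Meaningful only where \<open>g\<close> is differentiable.\<close>

definition gradient :: "('a::euclidean_space \<Rightarrow> real) \<Rightarrow> 'a \<Rightarrow> 'a" where
  "gradient g x = (THE d. GDERIV g x :> d)"

text \<open>On the interior of its domain an extended convex function is finite, so
  \<open>real_of_ereal\<close> loses nothing there.\<close>

definition essentially_smooth :: "('a::euclidean_space \<Rightarrow> ereal) \<Rightarrow> bool" where
  "essentially_smooth \<Lambda> \<longleftrightarrow>
     ext_convex \<Lambda> \<and>
     interior (eff_domain \<Lambda>) \<noteq> {} \<and>
     (\<forall>l \<in> interior (eff_domain \<Lambda>). (\<lambda>l. real_of_ereal (\<Lambda> l)) differentiable (at l)) \<and>
     (\<forall>s p. (\<forall>k::nat. s k \<in> interior (eff_domain \<Lambda>)) \<longrightarrow> p \<in> frontier (eff_domain \<Lambda>) \<longrightarrow>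
        s \<longlonglongrightarrow> p \<longrightarrow>
        filterlim (\<lambda>k. norm (gradient (\<lambda>l. real_of_ereal (\<Lambda> l)) (s k))) at_top sequentially)"

text \<open>\<open>V\<^sub>\<delta>(A)\<close>; the infimum is taken in the extended reals, so \<open>V\<^sub>\<delta>(\<emptyset>) = \<emptyset>\<close>.\<close>

definition nbhd :: "real \<Rightarrow> real set \<Rightarrow> real set" where
  "nbhd \<delta> A = {x. (INF y\<in>A. ereal \<bar>x - y\<bar>) < ereal \<delta>}"

text \<open>The points of a net need not belong to the set.\<close>

definition is_net :: "ereal \<Rightarrow> 'a::metric_space set \<Rightarrow> 'a set \<Rightarrow> bool" where
  "is_net \<epsilon> A N \<longleftrightarrow> finite N \<and> (\<forall>a\<in>A. \<exists>p\<in>N. ereal (dist a p) \<le> \<epsilon>)"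

text \<open>Diameter with values in the extended reals, so that it is \<open>\<infinity>\<close> for an unbounded set, for
  which the library's real-valued \<open>diameter\<close> is meaningless.\<close>

definition ediameter :: "'a::metric_space set \<Rightarrow> ereal" where
  "ediameter S = (SUP x\<in>S. SUP y\<in>S. ereal (dist x y))"

lemma ediameter_eq_diameter:
  assumes "bounded S" "S \<noteq> {}"
  shows "ediameter S = ereal (diameter S)"
proof (rule antisym)
  show "ediameter S \<le> ereal (diameter S)"
    unfolding ediameter_def
    by (intro SUP_least) (simp add: diameter_bounded_bound[OF assms(1)])
next
  obtain a where a: "a \<in> S" using assms(2) by blast
  have le: "ereal (dist x y) \<le> ediameter S" if "x \<in> S" "y \<in> S" for x y
    unfolding ediameter_def using that by (meson SUP_upper2 order_refl)
  have "0 \<le> ediameter S" using le[OF a a] by (simp add: zero_ereal_def)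
  show "ereal (diameter S) \<le> ediameter S"
  proof (cases "ediameter S")
    case (real d)
    have "diameter S \<le> d"
      unfolding diameter_def using assms(2) le real by (auto intro!: cSUP_least)
    then show ?thesis using real by simp
  qed (use \<open>0 \<le> ediameter S\<close> in auto)
qed

end

theory Submission
  imports Defs
begin

text \<open>Let \<open>S = {\<Lambda>\<^sup>* \<le> r}\<close>. As \<open>S\<close> is convex and \<open>f\<close> is continuous on \<open>K\<close>, \<open>f ` S\<close> is an interval,
  so a point \<open>x \<in> K\<close> whose value is \<open>\<delta>\<close>-far from \<open>{I \<le> r}\<close> lies at least \<open>\<delta>\<close> above, or at least
  \<open>\<delta>\<close> below, all values of \<open>f\<close> on \<open>S\<close>. By minimax one functional in \<open>W\<close>, and then one element \<open>p\<close>
  of the net, separates \<open>x\<close> from all of \<open>S\<close> with margin \<open>\<delta> / 2\<close>, up to sign. For each \<open>\<plusminus>p\<close> such \<open>x\<close>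
  form a closed convex set disjoint from \<open>S\<close>, which has probability at most \<open>exp (- r)\<close>. Altogether
  the probability is at most \<open>(1 + 2 |N|) exp (- r) \<le> exp 2 |N| exp (- r)\<close>.\<close>

section \<open>Barycenters and the exponential bound for closed convex sets\<close>

lemma set_integrable_id_bounded:
  fixes \<mu> :: "'a::euclidean_space measure"
  assumes "finite_measure \<mu>" and sets: "sets \<mu> = sets borel"
    and B: "B \<in> sets borel" "bounded B"
  shows "set_integrable \<mu> B (\<lambda>x. x)"
proof -
  interpret finite_measure \<mu> by fact
  note [measurable_cong] = sets
  note [measurable] = B(1)
  obtain R where R: "\<And>x. x \<in> B \<Longrightarrow> norm x \<le> R"
    using B(2) by (auto simp: bounded_iff)
  show ?thesis unfolding set_integrable_def
    by (rule integrable_const_bound[where B="max R 0"])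
      (auto simp: indicator_def R intro!: AE_I2 max.coboundedI1)
qed

text \<open>Let \<open>m\<close> be the barycenter. By the tangent inequality,
  \<open>exp (l \<bullet> x)\<close> is at least
  \<open>exp (l \<bullet> m) * (1 + l \<bullet> (x - m))\<close>. Integrating over \<open>B\<close>
  cancels the linear term, so the exponential integral is at least
  \<open>exp (l \<bullet> m) * measure \<mu> B\<close>. Taking logarithms bounds every term of the
  supremum.\<close>

lemma legendre_barycenter_le:
  fixes \<mu> :: "'a::euclidean_space measure"
  assumes "finite_measure \<mu>" and sets: "sets \<mu> = sets borel"
    and B: "B \<in> sets borel" "bounded B" and pos: "measure \<mu> B > 0"
  shows "legendre (log_laplace \<mu>) ((LINT x:B|\<mu>. x) /\<^sub>R measure \<mu> B) \<le> ereal (- ln (measure \<mu> B))"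
proof -
  interpret finite_measure \<mu> by fact
  define p where "p = measure \<mu> B"
  define J where "J = (LINT x:B|\<mu>. x)"
  define m where "m = J /\<^sub>R p"
  have p: "p > 0" using pos by (simp add: p_def)
  note [measurable_cong] = sets
  note [measurable] = B(1)
  have intx: "integrable \<mu> (\<lambda>x. indicator B x *\<^sub>R x)"
    using set_integrable_id_bounded[OF assms(1-4)] by (simp add: set_integrable_def)
  have intB: "integrable \<mu> (indicator B :: 'a \<Rightarrow> real)"
    by (rule integrable_const_bound[where B=1]) (auto simp: indicator_def)
  have "ereal (l \<bullet> m) - log_laplace \<mu> l \<le> ereal (- ln p)" for l
  proof (cases "integrable \<mu> (\<lambda>x. exp (l \<bullet> x))")
    case True
    \<comment> \<open>The tangent of \<open>exp (l \<bullet> x)\<close> at \<open>m\<close>, cut off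
      outside \<open>B\<close>; it is expanded so that only the integrals of
      \<open>indicator B\<close> and of \<open>indicator B x *\<^sub>R x\<close> occur.\<close>
    let ?g = "\<lambda>x. exp (l \<bullet> m) * ((1 - l \<bullet> m) * indicator B x + l \<bullet> (indicator B x *\<^sub>R x))"
    have "(\<integral>x. ?g x \<partial>\<mu>) = exp (l \<bullet> m) * ((1 - l \<bullet> m) * p + l \<bullet> J)"
      using intx intB
      by (simp add: J_def set_lebesgue_integral_def p_def sets_eq_imp_space_eq[OF sets] del: inner_scaleR_right)
    \<comment> \<open>The linear part vanishes because
      \<open>l \<bullet> J = p * (l \<bullet> m)\<close>.\<close>
    also have "\<dots> = exp (l \<bullet> m) * p"
      using p by (simp add: m_def field_simps)
    finally have eq: "(\<integral>x. ?g x \<partial>\<mu>) = exp (l \<bullet> m) * p" .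
    have "(\<integral>x. ?g x \<partial>\<mu>) \<le> (\<integral>x. exp (l \<bullet> x) \<partial>\<mu>)"
    proof (rule integral_mono)
      show "integrable \<mu> ?g" using intx intB by (simp del: inner_scaleR_right)
      show "?g x \<le> exp (l \<bullet> x)" for x
      proof (cases "x \<in> B")
        case True
        have "exp (l \<bullet> m) * (1 + (l \<bullet> x - l \<bullet> m)) \<le> exp (l \<bullet> m) * exp (l \<bullet> x - l \<bullet> m)"
          by (intro mult_left_mono exp_ge_add_one_self) auto
        also have "\<dots> = exp (l \<bullet> x)" by (simp flip: exp_add)
        finally show ?thesis using True by (simp add: algebra_simps)
      qed simp
    qed (rule True)
    then have ge: "exp (l \<bullet> m) * p \<le> (\<integral>x. exp (l \<bullet> x) \<partial>\<mu>)" (is "_ \<le> ?E") using eq by simp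
    have E0: "?E > 0" using ge p by (smt (verit) exp_gt_zero mult_pos_pos)
    have "l \<bullet> m + ln p = ln (exp (l \<bullet> m) * p)" using p by (simp add: ln_mult)
    also have "\<dots> \<le> ln ?E" using ge p by (subst ln_le_cancel_iff) (auto simp: E0)
    finally have "l \<bullet> m - ln ?E \<le> - ln p" by simp
    moreover have "log_laplace \<mu> l = ereal (ln ?E)"
      unfolding log_laplace_def using True E0
      by (subst nn_integral_eq_integral) (auto simp: elog_def)
    ultimately show ?thesis by simp
  next
    case False
    \<comment> \<open>A divergent integral makes \<open>log_laplace \<mu> l\<close> equal to
      \<infinity>, so this \<open>l\<close> contributes -\<infinity> to the supremum.\<close>
    have "(\<integral>\<^sup>+ x. ennreal (exp (l \<bullet> x)) \<partial>\<mu>) = \<infinity>"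
    proof (rule ccontr)
      assume "\<not> ?thesis"
      then have "integrable \<mu> (\<lambda>x. exp (l \<bullet> x))"
        by (intro integrableI_nonneg) (auto simp: less_top)
      with False show False by simp
    qed
    then show ?thesis by (simp add: log_laplace_def elog_def)
  qed
  then show ?thesis unfolding legendre_def p_def J_def m_def by (intro SUP_least)
qed

text \<open>Otherwise a hyperplane strictly separates the barycenter from \<open>C\<close>;
  integrating its inequality over \<open>B\<close> puts the barycenter on the side of
  \<open>C\<close>.\<close>

lemma barycenter_in_closed_convex:
  fixes \<mu> :: "'a::euclidean_space measure"
  assumes "finite_measure \<mu>" and sets: "sets \<mu> = sets borel"
    and B: "B \<in> sets borel" "bounded B" and pos: "measure \<mu> B > 0"
    and C: "closed C" "convex C" "B \<subseteq> C"
  shows "(LINT x:B|\<mu>. x) /\<^sub>R measure \<mu> B \<in> C"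
proof (rule ccontr)
  interpret finite_measure \<mu> by fact
  note [measurable_cong] = sets
  note [measurable] = B(1)
  let ?p = "measure \<mu> B" and ?J = "LINT x:B|\<mu>. x"
  assume "?J /\<^sub>R ?p \<notin> C"
  then obtain a b where ab: "a \<bullet> (?J /\<^sub>R ?p) < b" "\<And>x. x \<in> C \<Longrightarrow> a \<bullet> x > b"
    using separating_hyperplane_closed_point[OF C(2,1)] by metis
  have intx: "integrable \<mu> (\<lambda>x. indicator B x *\<^sub>R x)"
    using set_integrable_id_bounded[OF assms(1-4)] by (simp add: set_integrable_def)
  have intB: "integrable \<mu> (indicator B :: 'a \<Rightarrow> real)"
    by (rule integrable_const_bound[where B=1]) (auto simp: indicator_def)
  have "(\<integral>x. b * indicator B x \<partial>\<mu>) \<le> (\<integral>x. a \<bullet> (indicator B x *\<^sub>R x) \<partial>\<mu>)"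
  proof (rule integral_mono)
    show "b * indicator B x \<le> a \<bullet> (indicator B x *\<^sub>R x)" for x
      using ab(2)[of x] C(3) by (auto simp: indicator_def intro: less_imp_le)
  qed (use intx intB in \<open>auto simp del: inner_scaleR_right\<close>)
  then have "b * ?p \<le> a \<bullet> ?J"
    using intx intB
    by (simp add: set_lebesgue_integral_def sets_eq_imp_space_eq[OF sets] del: inner_scaleR_right)
  then show False using ab(1) pos by (simp add: field_simps)
qed

text \<open>Chernoff's bound without duality: by Jensen, the Legendre transform at the barycenter of
  \<open>\<mu>\<close> conditioned to a set \<open>B\<close> is at most \<open>- ln (\<mu> B)\<close>.\<close>

lemma measure_closed_convex_le_exp:
  fixes \<mu> :: "'a::euclidean_space measure"
  assumes "finite_measure \<mu>" and sets: "sets \<mu> = sets borel"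
    and C: "closed C" "convex C"
    and gt: "\<And>y. y \<in> C \<Longrightarrow> legendre (log_laplace \<mu>) y > ereal r"
  shows "measure \<mu> C \<le> exp (- r)"
proof -
  interpret finite_measure \<mu> by fact
  \<comment> \<open>The truncation makes the barycenter meaningful although \<open>\<mu>\<close> may
    have no first moment; continuity from below removes it at the end.\<close>
  let ?B = "\<lambda>k::nat. C \<inter> cball 0 (real k)"
  have C_borel: "?B k \<in> sets borel" for k using C by auto
  have "measure \<mu> (?B k) \<le> exp (- r)" for k
  proof (cases "measure \<mu> (?B k) > 0")
    case True
    have bdd: "bounded (?B k)" by (auto intro: bounded_subset[OF bounded_cball])
    let ?m = "(LINT x:?B k|\<mu>. x) /\<^sub>R measure \<mu> (?B k)"
    have "?m \<in> C"
      using barycenter_in_closed_convex[OF assms(1,2) C_borel bdd True C] by blast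
    from gt[OF this] legendre_barycenter_le[OF assms(1,2) C_borel bdd True]
    have "r < - ln (measure \<mu> (?B k))" using less_le_trans by fastforce
    then have "ln (measure \<mu> (?B k)) \<le> - r" by simp
    then show ?thesis using True by (metis exp_le_cancel_iff exp_ln)
  next
    case False
    then show ?thesis by (smt (verit) exp_ge_zero)
  qed
  moreover have "(\<lambda>k. measure \<mu> (?B k)) \<longlonglongrightarrow> measure \<mu> (\<Union>k. ?B k)"
    using C_borel by (intro finite_Lim_measure_incseq) (auto simp: sets incseq_def)
  moreover have "(\<Union>k. ?B k) = C"
    using real_arch_simple by fastforce
  ultimately show ?thesis by (metis LIMSEQ_le_const2)
qed

section \<open>Convexity of sublevel sets, and choice of one functional for a whole convex
  set\<close>

lemma closed_convex_legendre_sublevel: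
  fixes \<Lambda> :: "'a::euclidean_space \<Rightarrow> ereal"
  shows "closed {x. legendre \<Lambda> x \<le> ereal k}" "convex {x. legendre \<Lambda> x \<le> ereal k}"
proof -
  have eq: "{x. legendre \<Lambda> x \<le> ereal k} = (\<Inter>l. {x. ereal (l \<bullet> x) - \<Lambda> l \<le> ereal k})"
    by (auto simp: legendre_def SUP_le_iff)
  \<comment> \<open>Each constraint is a closed half-space when \<open>\<Lambda> l\<close> is
    finite, the whole space when it is \<infinity>, and empty when it is -\<infinity>.\<close>
  have "closed {x. ereal (l \<bullet> x) - \<Lambda> l \<le> ereal k} \<and> convex {x. ereal (l \<bullet> x) - \<Lambda> l \<le> ereal k}" for l
  proof (cases "\<Lambda> l")
    case (real t)
    then have "{x. ereal (l \<bullet> x) - \<Lambda> l \<le> ereal k} = {x. l \<bullet> x \<le> k + t}" by auto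
    then show ?thesis by (simp add: closed_halfspace_le convex_halfspace_le)
  qed auto
  then show "closed {x. legendre \<Lambda> x \<le> ereal k}" "convex {x. legendre \<Lambda> x \<le> ereal k}"
    unfolding eq by (auto intro!: convex_INT)
qed

text \<open>A minimax statement, obtained by separating the strict epigraph of the support function of
  \<open>W\<close> from \<open>U \<times> {d}\<close>.\<close>

lemma uniform_functional_in_compact_convex:
  fixes W U :: "'a::euclidean_space set"
  assumes W: "compact W" "convex W" and U: "convex U" "U \<noteq> {}"
    and ge: "\<And>u. u \<in> U \<Longrightarrow> \<exists>l\<in>W. l \<bullet> u \<ge> d"
  shows "\<exists>l\<in>W. \<forall>u\<in>U. l \<bullet> u \<ge> d"
proof -
  define A where "A = {(u, t::real). \<forall>l\<in>W. l \<bullet> u < t}"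
  obtain R where R: "\<And>x. x \<in> W \<Longrightarrow> norm x \<le> R" and "R > 0"
    using compact_imp_bounded[OF W(1)] by (auto simp: bounded_pos)
  \<comment> \<open>\<open>R * norm u\<close> dominates the support function of \<open>W\<close>.
    This gives points of \<open>A\<close> over every \<open>u\<close>, and over 0 at every positive
    height.\<close>
  have pos_in: "(u, R * norm u + t) \<in> A" if "t > 0" for u t
  proof -
    have "l \<bullet> u \<le> R * norm u" if "l \<in> W" for l
      using norm_cauchy_schwarz[of l u] R[OF that] by (smt (verit) mult_right_mono norm_ge_zero)
    then show ?thesis using that unfolding A_def by fastforce
  qed
  have "A = (\<Inter>l\<in>W. {z. (l, -1) \<bullet> z < 0})"
    by (auto simp: A_def)
  then have "convex A" by (auto intro!: convex_INT convex_halfspace_lt simp only:)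
  moreover have "convex (U \<times> {d})" using U by (intro convex_Times) auto
  moreover have "U \<times> {d} \<noteq> {}" using U by simp
  moreover have "A \<noteq> {}" using pos_in[of 1] by auto
  moreover have "(U \<times> {d}) \<inter> A = {}"
    using ge by (fastforce simp: A_def)
  ultimately obtain z c where z: "z \<noteq> 0" "\<And>x. x \<in> U \<times> {d} \<Longrightarrow> z \<bullet> x \<le> c" "\<And>x. x \<in> A \<Longrightarrow> z \<bullet> x \<ge> c"
    using separating_hyperplane_sets[of "U \<times> {d}" A] by metis
  obtain a b where ab: "z = (a, b)" by (cases z)
  have cA: "a \<bullet> u + b * t \<ge> c" if "(u, t) \<in> A" for u t using z(3)[OF that] by (simp add: ab)
  have cone: "(s *\<^sub>R u, s * t) \<in> A" if "(u, t) \<in> A" "s > 0" for u t s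
    using that by (auto simp: A_def)
  \<comment> \<open>\<open>A\<close> is a cone, so a lower bound \<open>c\<close> on it improves to
    0: scaling a point of negative value by \<open>s\<close> would give the value
    \<open>- (\<bar>c\<bar> + 1)\<close>, below \<open>c\<close>.\<close>
  have ge0: "a \<bullet> u + b * t \<ge> 0" if "(u, t) \<in> A" for u t
  proof (rule ccontr)
    assume neg: "\<not> ?thesis"
    define q where "q = - (a \<bullet> u + b * t)"
    have q: "q > 0" using neg by (simp add: q_def)
    define s where "s = (\<bar>c\<bar> + 1) / q"
    have "s > 0" using q by (simp add: s_def)
    from cA[OF cone[OF that this]] have "- (s * q) \<ge> c" by (simp add: q_def algebra_simps)
    moreover have "s * q = \<bar>c\<bar> + 1" using q by (simp add: s_def)
    ultimately show False by linarith
  qed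
  \<comment> \<open>The points \<open>(0, t)\<close> of \<open>A\<close> have value
    \<open>b * t\<close>, which tends to 0 with \<open>t\<close>; the chosen \<open>t\<close> makes
    it at most \<open>c / 2\<close>.\<close>
  have "c \<le> 0"
  proof (rule ccontr)
    assume c: "\<not> c \<le> 0"
    define t where "t = c / (2 * (\<bar>b\<bar> + 1))"
    have t: "t > 0" using c by (simp add: t_def)
    have "c \<le> b * t" using cA[OF pos_in[OF t, of 0]] by simp
    also have "\<dots> \<le> (\<bar>b\<bar> + 1) * t" using t by (intro mult_right_mono) auto
    also have "\<dots> = c / 2" by (simp add: t_def divide_simps)
    finally show False using c by simp
  qed
  \<comment> \<open>The separating hyperplane is not vertical: since \<open>A\<close> has points
    over every \<open>u\<close>, \<open>a\<close> would be nonnegative in all directions, hence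
    zero.\<close>
  have "b \<noteq> 0"
  proof
    assume "b = 0"
    then have "a \<bullet> u \<ge> 0" for u using ge0[OF pos_in[of 1 u]] by simp
    from this[of "- a"] have "a \<bullet> a \<le> 0" by simp
    then have "a = 0" by (metis antisym inner_eq_zero_iff inner_ge_zero)
    with \<open>b = 0\<close> z(1) show False by (simp add: ab zero_prod_def)
  qed
  moreover have "b \<ge> 0" using ge0[OF pos_in[of 1 0]] by simp
  ultimately have b: "b > 0" by simp
  \<comment> \<open>Normalizing the last coefficient of the normal turns \<open>ge0\<close> into
    \<open>l \<bullet> u \<le> t\<close> on \<open>A\<close>; thus \<open>l\<close> is dominated by
    the support function of \<open>W\<close>.\<close>
  define l where "l = - (a /\<^sub>R b)"
  have a: "a = - (b *\<^sub>R l)" using b by (simp add: l_def)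
  have "l \<in> W"
  proof (rule ccontr)
    assume "l \<notin> W"
    then obtain v \<beta> where v: "v \<bullet> l < \<beta>" "\<And>x. x \<in> W \<Longrightarrow> v \<bullet> x > \<beta>"
      using separating_hyperplane_closed_point[OF W(2) compact_imp_closed[OF W(1)]] by metis
    \<comment> \<open>A separator of \<open>l\<close> from \<open>W\<close> is itself a point of the
      epigraph, at which \<open>l\<close> violates \<open>ge0\<close>.\<close>
    have "(- v, - \<beta>) \<in> A" using v(2) by (auto simp: A_def inner_commute)
    from ge0[OF this] have "b * (v \<bullet> l - \<beta>) \<ge> 0"
      by (simp add: a algebra_simps inner_commute)
    then show False using b v(1) by (simp add: zero_le_mult_iff)
  qed
  moreover have "l \<bullet> u \<ge> d" if "u \<in> U" for u
  proof -
    have "b * d \<le> b * (l \<bullet> u)" using z(2)[of "(u, d)"] that \<open>c \<le> 0\<close> by (simp add: ab a)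
    then show ?thesis using b by simp
  qed
  ultimately show ?thesis by blast
qed

text \<open>Moving the common functional to a net point at distance at most
  \<open>\<delta> / (2 * D)\<close> changes its value on a vector of norm at most \<open>D\<close>
  by at most \<open>\<delta> / 2\<close>.\<close>

lemma uniform_functional_in_net:
  fixes W U N :: "'a::euclidean_space set" and D :: ereal
  assumes W: "compact W" "convex W" and U: "convex U" "U \<noteq> {}"
    and net: "is_net (ereal \<delta> / (2 * D)) W N" and "\<delta> > 0"
    and D: "\<And>u. u \<in> U \<Longrightarrow> ereal (norm u) \<le> D"
    and ge: "\<And>u. u \<in> U \<Longrightarrow> \<exists>l\<in>W. l \<bullet> u \<ge> \<delta>"
  shows "\<exists>p\<in>N. \<forall>u\<in>U. p \<bullet> u \<ge> \<delta> / 2"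
proof -
  obtain l where l: "l \<in> W" "\<And>u. u \<in> U \<Longrightarrow> l \<bullet> u \<ge> \<delta>"
    using uniform_functional_in_compact_convex[OF W U ge] by blast
  obtain p where p: "p \<in> N" "ereal (dist l p) \<le> ereal \<delta> / (2 * D)"
    using net l(1) by (auto simp: is_net_def)
  have "p \<bullet> u \<ge> \<delta> / 2" if u: "u \<in> U" for u
  proof -
    \<comment> \<open>The vector 0 is excluded from \<open>U\<close>, so a finite \<open>D\<close>
      is positive and the mesh is a genuine quotient.\<close>
    have pos: "norm u > 0" using l(2)[OF u] \<open>\<delta> > 0\<close> by auto
    have "dist l p * norm u \<le> \<delta> / 2"
    proof (cases D)
      case (real d)
      have d: "norm u \<le> d" using D[OF u] real by simp
      then have "d > 0" using pos by linarith
      have "dist l p \<le> \<delta> / (2 * d)" using p(2) \<open>d > 0\<close> real by simp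
      then have "dist l p * norm u \<le> \<delta> / (2 * d) * d"
        using d \<open>d > 0\<close> \<open>\<delta> > 0\<close> by (intro mult_mono) auto
      then show ?thesis using \<open>d > 0\<close> by simp
    next
      \<comment> \<open>The mesh \<open>\<delta> / \<infinity>\<close> is 0, so \<open>p\<close>
        coincides with \<open>l\<close>.\<close>
      case PInf
      then have "dist l p \<le> 0" using p(2) by (simp add: zero_ereal_def)
      then show ?thesis using \<open>\<delta> > 0\<close> by simp
    next
      case MInf
      then show ?thesis using D[OF u] by simp
    qed
    moreover have "(l - p) \<bullet> u \<le> dist l p * norm u"
      using norm_cauchy_schwarz[of "l - p" u] by (simp add: dist_norm)
    ultimately show ?thesis using l(2)[OF u] by (simp add: inner_diff_left)
  qed
  with p(1) show ?thesis by blast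
qed

section \<open>Regularity of \<open>f\<close> on \<open>K\<close>, and the position of a value
  relative to an interval\<close>

lemma le_SUP_inner_compactD:
  fixes W :: "'a::euclidean_space set"
  assumes "compact W" "ereal c \<le> (SUP l\<in>W. ereal (l \<bullet> u))"
  shows "\<exists>l\<in>W. c \<le> l \<bullet> u"
proof -
  \<comment> \<open>The supremum over the empty set is -\<infinity>, hence not above a real
    \<open>c\<close>.\<close>
  have "W \<noteq> {}" using assms(2) by (auto simp: bot_ereal_def)
  moreover have "continuous_on W (\<lambda>l. l \<bullet> u)" by (intro continuous_intros)
  ultimately obtain l where l: "l \<in> W" "\<And>l'. l' \<in> W \<Longrightarrow> l' \<bullet> u \<le> l \<bullet> u"
    using continuous_attains_sup[OF assms(1)] by blast
  have "(SUP l\<in>W. ereal (l \<bullet> u)) \<le> ereal (l \<bullet> u)"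
    using l(2) by (intro SUP_least) simp
  with assms(2) l(1) show ?thesis by (metis ereal_less_eq(3) order_trans)
qed

text \<open>A bound on the norms in \<open>W\<close> is a Lipschitz constant of \<open>f\<close>:
  use the hypothesis for \<open>x\<close>, \<open>y\<close> in both orders.\<close>

lemma continuous_on_if_le_SUP_inner:
  fixes f :: "'a::euclidean_space \<Rightarrow> real"
  assumes W: "compact W"
    and f: "\<And>x y. x \<in> K \<Longrightarrow> y \<in> K \<Longrightarrow> ereal (f x - f y) \<le> (SUP l\<in>W. ereal (l \<bullet> (x - y)))"
  shows "continuous_on K f"
proof -
  obtain R where R: "\<And>l. l \<in> W \<Longrightarrow> norm l \<le> R" and "R > 0"
    using compact_imp_bounded[OF W] by (auto simp: bounded_pos)
  have le: "f x - f y \<le> R * dist x y" if xy: "x \<in> K" "y \<in> K" for x y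
  proof -
    obtain l where l: "l \<in> W" "f x - f y \<le> l \<bullet> (x - y)"
      using le_SUP_inner_compactD[OF W f[OF xy]] by blast
    have "l \<bullet> (x - y) \<le> norm l * dist x y" by (simp add: dist_norm norm_cauchy_schwarz)
    also have "\<dots> \<le> R * dist x y" using R[OF l(1)] by (intro mult_right_mono) auto
    finally show ?thesis using l(2) by simp
  qed
  have "dist (f x) (f y) \<le> R * dist x y" if "x \<in> K" "y \<in> K" for x y
    using le[OF that] le[OF that(2,1)] by (simp add: dist_real_def dist_commute)
  then have "R-lipschitz_on K f" using \<open>R > 0\<close> by (intro lipschitz_onI) auto
  then show ?thesis by (rule lipschitz_on_continuous_on)
qed

text \<open>An interval with points on both sides of \<open>t\<close> would contain \<open>t\<close>
  itself, at distance 0.\<close>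

lemma connected_avoids_ball:
  fixes S :: "real set"
  assumes "connected S" "\<delta> > 0" "\<And>s. s \<in> S \<Longrightarrow> \<bar>t - s\<bar> \<ge> \<delta>"
  shows "(\<forall>s\<in>S. t - s \<ge> \<delta>) \<or> (\<forall>s\<in>S. s - t \<ge> \<delta>)"
proof (rule ccontr)
  assume "\<not> ?thesis"
  then obtain s s' where "s \<in> S" "s' \<in> S" "t - s < \<delta>" "s' - t < \<delta>" by (auto simp: not_le)
  then have "s' \<le> t" "t \<le> s" using assms(3)[of s] assms(3)[of s'] by linarith+
  then have "t \<in> S" using connectedD_interval[OF assms(1) \<open>s' \<in> S\<close> \<open>s \<in> S\<close>] by blast
  with assms(2) assms(3)[of t] show False by simp
qed

lemma notin_nbhdD:
  assumes "x \<notin> nbhd \<delta> A" "y \<in> A"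
  shows "\<bar>x - y\<bar> \<ge> \<delta>"
proof -
  have "ereal \<delta> \<le> (INF y\<in>A. ereal \<bar>x - y\<bar>)" using assms(1) by (simp add: nbhd_def not_less)
  also have "\<dots> \<le> ereal \<bar>x - y\<bar>" using assms(2) by (rule INF_lower)
  finally show ?thesis by simp
qed

lemma elog_mono:
  assumes "0 \<le> x" "x \<le> y"
  shows "elog (ereal x) \<le> elog (ereal y)"
  using assms by (auto simp: elog_def zero_ereal_def)

lemma elog_nonneg:
  assumes "x \<ge> 1"
  shows "elog x \<ge> 0"
  using assms by (cases x) (auto simp: elog_def one_ereal_def zero_ereal_def)


section \<open>Covering of the exceptional event by closed convex sets, and the union bound\<close>

theorem theorem1p5:
  fixes M :: "'w measure"
    and X :: "'w \<Rightarrow> real ^ 'n"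
    and \<mu> :: "(real ^ 'n) measure"
    and f :: "real ^ 'n \<Rightarrow> real"
    and I :: "real \<Rightarrow> ereal"
    and r \<kappa> \<delta> :: real
    and K W N :: "(real ^ 'n) set"
    and D L :: ereal
  assumes "prob_space M"
    and "X \<in> borel_measurable M"
    and "\<mu> = distr M borel X"
    and "\<not> (\<exists>H. hyperplane H \<and> msupport \<mu> \<subseteq> H)"
    and "essentially_smooth (log_laplace \<mu>)"
    and "f \<in> borel_measurable borel"
    and "\<And>t. I t = (INF y\<in>{y. f y = t}. legendre (log_laplace \<mu>) y)"
    and "r > 0"
    and "\<kappa> \<ge> r"
    and "K = {x. legendre (log_laplace \<mu>) x \<le> ereal \<kappa>}"
    and "measure M {\<omega> \<in> space M. X \<omega> \<notin> K} \<le> exp (- r)"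
    and "compact W"
    and "convex W"
    and "\<forall>x\<in>K. \<forall>y\<in>K. ereal (f x - f y) \<le> (SUP l\<in>W. ereal (l \<bullet> (x - y)))"
    and "D = ediameter K"
    and "\<delta> > 0"
    and "is_net (ereal \<delta> / (2 * D)) W N"
    and "L = (SUP l\<in>W. ereal (norm l))"
  shows "elog (ereal (measure M {\<omega> \<in> space M. f (X \<omega>) \<notin> nbhd \<delta> {t. I t \<le> ereal r}}))
      \<le> - ereal r + elog (ereal (real (card N)))
         + elog (max (ereal \<kappa> * L * D / ereal \<delta>) 1) + 2"
proof -
  interpret prob_space M by fact
  note [measurable] = assms(2)
  define S where "S = {x. legendre (log_laplace \<mu>) x \<le> ereal r}"
  define C where "C q = {x. \<forall>y\<in>S. q \<bullet> (x - y) \<ge> \<delta> / 2}" for q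
  define Q where "Q = N \<union> uminus ` N"
  define E where "E = {\<omega> \<in> space M. f (X \<omega>) \<notin> nbhd \<delta> {t. I t \<le> ereal r}}"
  interpret \<mu>: prob_space \<mu> unfolding assms(3) by (rule prob_space_distr) fact
  have sets: "sets \<mu> = sets borel" by (simp add: assms(3))
  have prob_X: "measure \<mu> B = measure M {\<omega> \<in> space M. X \<omega> \<in> B}" if "B \<in> sets borel" for B
    unfolding assms(3) using that by (subst measure_distr) (auto simp: vimage_def Int_def conj_commute)
  have S: "convex S" "S \<subseteq> K"
    unfolding S_def assms(10)
    using closed_convex_legendre_sublevel(2) \<open>\<kappa> \<ge> r\<close> by (auto intro: order_trans)
  have K: "K \<in> sets borel"
    unfolding assms(10) by (intro borel_closed closed_convex_legendre_sublevel)
  \<comment> \<open>Otherwise the exponential bound applies to the whole space and gives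
    \<open>1 \<le> exp (- r)\<close>, against \<open>r > 0\<close>.\<close>
  have "S \<noteq> {}"
  proof
    assume "S = {}"
    then have "measure \<mu> UNIV \<le> exp (- r)"
      by (intro measure_closed_convex_le_exp \<mu>.finite_measure_axioms sets) (auto simp: S_def not_le)
    then show False using \<mu>.prob_space \<open>r > 0\<close> by (simp add: sets_eq_imp_space_eq[OF sets])
  qed
  have diam: "ereal (norm (x - y)) \<le> D" if "x \<in> K" "y \<in> K" for x y
    unfolding assms(15) ediameter_def dist_norm using that by (meson SUP_upper2 order_refl)
  have f: "ereal (f x - f y) \<le> (SUP l\<in>W. ereal (l \<bullet> (x - y)))" if "x \<in> K" "y \<in> K" for x y
    using assms(14) that by blast
  have fin: "finite N" "finite Q" using assms(17) by (auto simp: is_net_def Q_def)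
  have C_closed: "closed (C q)" and C_convex: "convex (C q)" for q
  proof -
    have "C q = (\<Inter>y\<in>S. {x. q \<bullet> x \<ge> \<delta> / 2 + q \<bullet> y})"
      by (auto simp: C_def inner_diff_right algebra_simps)
    then show "closed (C q)" "convex (C q)"
      by (auto intro!: closed_INT convex_INT closed_halfspace_ge convex_halfspace_ge)
  qed
  have C_borel: "C q \<in> sets borel" for q using C_closed by (rule borel_closed)
  have prob_C: "measure M {\<omega> \<in> space M. X \<omega> \<in> C q} \<le> exp (- r)" for q
  proof -
    \<comment> \<open>A common point, taken as its own \<open>y\<close>, would give
      \<open>0 \<ge> \<delta> / 2\<close>.\<close>
    have "C q \<inter> S = {}" using \<open>\<delta> > 0\<close> by (force simp: C_def)
    then have "measure \<mu> (C q) \<le> exp (- r)"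
      by (intro measure_closed_convex_le_exp \<mu>.finite_measure_axioms sets C_closed C_convex)
        (auto simp: S_def not_le)
    then show ?thesis by (simp add: prob_X[OF C_borel])
  qed
  have cover: "\<exists>q\<in>Q. x \<in> C q" if x: "x \<in> K" "f x \<notin> nbhd \<delta> {t. I t \<le> ereal r}" for x
  proof -
    have far: "\<bar>f x - s\<bar> \<ge> \<delta>" if "s \<in> f ` S" for s
    proof (rule notin_nbhdD[OF x(2)])
      from that obtain y where "s = f y" "y \<in> S" by blast
      then have "I s \<le> legendre (log_laplace \<mu>) y"
        unfolding assms(7) by (intro INF_lower) simp
      then show "s \<in> {t. I t \<le> ereal r}" using \<open>y \<in> S\<close> by (auto simp: S_def)
    qed
    have conn: "connected (f ` S)"
      using continuous_on_if_le_SUP_inner[OF \<open>compact W\<close> f] S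
      by (intro connected_continuous_image convex_connected) (auto intro: continuous_on_subset)
    from connected_avoids_ball[OF conn \<open>\<delta> > 0\<close> far]
    consider "\<forall>y\<in>S. f x - f y \<ge> \<delta>" | "\<forall>y\<in>S. f y - f x \<ge> \<delta>" by auto
    then show ?thesis
    proof cases
      case 1
      \<comment> \<open>For each \<open>y\<close> the hypothesis on \<open>f\<close> yields a
        functional in \<open>W\<close> of value at least \<open>f x - f y \<ge> \<delta>\<close> on
        \<open>x - y\<close>; the net lemma makes the choice independent of
        \<open>y\<close>.\<close>
      have "\<exists>p\<in>N. \<forall>u\<in>(\<lambda>y. x - y) ` S. p \<bullet> u \<ge> \<delta> / 2"
      proof (rule uniform_functional_in_net[OF \<open>compact W\<close> \<open>convex W\<close> _ _ assms(17) \<open>\<delta> > 0\<close>])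
        show "convex ((\<lambda>y. x - y) ` S)"
          using convex_translation[OF convex_negations[OF S(1)], of x] by (simp add: image_image)
        fix u assume "u \<in> (\<lambda>y. x - y) ` S"
        then obtain y where y: "y \<in> S" "u = x - y" by blast
        then have "y \<in> K" using S(2) by blast
        then show "ereal (norm u) \<le> D" using diam x(1) y(2) by blast
        obtain l where "l \<in> W" "f x - f y \<le> l \<bullet> (x - y)"
          using le_SUP_inner_compactD[OF \<open>compact W\<close> f[of x y]] x(1) \<open>y \<in> K\<close> by blast
        then show "\<exists>l\<in>W. l \<bullet> u \<ge> \<delta>"
          using 1 y by (intro bexI[of _ l]) (auto intro: order_trans)
      qed (use \<open>S \<noteq> {}\<close> in simp)
      then show ?thesis by (auto simp: Q_def C_def)
    next
      case 2
      have "\<exists>p\<in>N. \<forall>u\<in>(\<lambda>y. y - x) ` S. p \<bullet> u \<ge> \<delta> / 2"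
      proof (rule uniform_functional_in_net[OF \<open>compact W\<close> \<open>convex W\<close> _ _ assms(17) \<open>\<delta> > 0\<close>])
        show "convex ((\<lambda>y. y - x) ` S)"
          using convex_translation_subtract[OF S(1)] by simp
        fix u assume "u \<in> (\<lambda>y. y - x) ` S"
        then obtain y where y: "y \<in> S" "u = y - x" by blast
        then have "y \<in> K" using S(2) by blast
        then show "ereal (norm u) \<le> D" using diam x(1) y(2) by blast
        obtain l where "l \<in> W" "f y - f x \<le> l \<bullet> (y - x)"
          using le_SUP_inner_compactD[OF \<open>compact W\<close> f[of y x]] x(1) \<open>y \<in> K\<close> by blast
        then show "\<exists>l\<in>W. l \<bullet> u \<ge> \<delta>"
          using 2 y by (intro bexI[of _ l]) (auto intro: order_trans)
      qed (use \<open>S \<noteq> {}\<close> in simp)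
      then obtain p where "p \<in> N" "- p \<in> Q" "x \<in> C (- p)"
        by (auto simp: Q_def C_def inner_diff_right)
      then show ?thesis by blast
    qed
  qed
  \<comment> \<open>The hypothesis on \<open>f\<close> at \<open>x = y\<close> forces
    \<open>W\<close> to be nonempty. Then \<open>card N \<ge> 1\<close>, which keeps its logarithm
    finite and lets \<open>exp (- r)\<close> be absorbed below.\<close>
  have "N \<noteq> {}"
  proof -
    obtain y where "y \<in> K" using \<open>S \<noteq> {}\<close> S(2) by blast
    then obtain l where "l \<in> W"
      using le_SUP_inner_compactD[OF \<open>compact W\<close> f, of y y] by blast
    then show ?thesis using assms(17) by (auto simp: is_net_def)
  qed
  then have N1: "card N \<ge> 1" using fin by (simp add: Suc_leI card_gt_0_iff)
  then have N_pos: "real (card N) > 0" by simp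
  have K_ev: "{\<omega> \<in> space M. X \<omega> \<notin> K} \<in> sets M" using K by measurable
  have C_ev: "{\<omega> \<in> space M. X \<omega> \<in> C q} \<in> sets M" for q using C_borel by measurable
  have "E \<subseteq> {\<omega> \<in> space M. X \<omega> \<notin> K} \<union> (\<Union>q\<in>Q. {\<omega> \<in> space M. X \<omega> \<in> C q})"
    using cover by (auto simp: E_def)
  then have "measure M E \<le> measure M ({\<omega> \<in> space M. X \<omega> \<notin> K} \<union> (\<Union>q\<in>Q. {\<omega> \<in> space M. X \<omega> \<in> C q}))"
    using K_ev C_ev fin by (intro finite_measure_mono) auto
  also have "\<dots> \<le> measure M {\<omega> \<in> space M. X \<omega> \<notin> K} + measure M (\<Union>q\<in>Q. {\<omega> \<in> space M. X \<omega> \<in> C q})"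
    using K_ev C_ev fin by (intro measure_Un_le) auto
  also have "measure M (\<Union>q\<in>Q. {\<omega> \<in> space M. X \<omega> \<in> C q}) \<le> (\<Sum>q\<in>Q. measure M {\<omega> \<in> space M. X \<omega> \<in> C q})"
    using C_ev fin by (intro measure_UNION_le) auto
  also have "\<dots> \<le> (\<Sum>q\<in>Q. exp (- r))" by (intro sum_mono prob_C)
  also have "\<dots> \<le> 2 * real (card N) * exp (- r)"
  proof -
    have "card Q \<le> card N + card (uminus ` N)" unfolding Q_def by (rule card_Un_le)
    also have "\<dots> \<le> 2 * card N" using card_image_le[OF fin(1)] by (simp add: mult_2)
    finally show ?thesis by simp
  qed
  finally have "measure M E \<le> exp (- r) + 2 * real (card N) * exp (- r)"
    using assms(11) by simp
  \<comment> \<open>Source of the additive constant 2: with \<open>n = card N \<ge> 1\<close>,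
    \<open>1 + 2 * n \<le> 3 * n\<close>, and \<open>exp 2 \<ge> 1 + 2\<close>.\<close>
  also have "\<dots> \<le> exp 2 * real (card N) * exp (- r)"
  proof -
    have "1 + 2 * real (card N) \<le> 3 * real (card N)" using N1 by simp
    also have "\<dots> \<le> exp 2 * real (card N)"
      using exp_ge_add_one_self[of 2] by (intro mult_right_mono) auto
    finally have "(1 + 2 * real (card N)) * exp (- r) \<le> exp 2 * real (card N) * exp (- r)"
      by (rule mult_right_mono) simp
    then show ?thesis by (simp add: distrib_right)
  qed
  finally have bound: "measure M E \<le> exp 2 * real (card N) * exp (- r)" .
  have "elog (ereal (measure M E)) \<le> elog (ereal (exp 2 * real (card N) * exp (- r)))"
    by (intro elog_mono measure_nonneg bound)
  also have "\<dots> = ereal (ln (exp 2 * real (card N) * exp (- r)))"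
    using N_pos by (simp add: elog_def not_le zero_ereal_def)
  also have "\<dots> = ereal (- r + ln (real (card N)) + 2)"
    using N_pos by (simp add: ln_mult)
  also have "\<dots> = - ereal r + elog (ereal (real (card N))) + 0 + 2"
    using N_pos by (simp add: elog_def zero_ereal_def numeral_eq_ereal)
  \<comment> \<open>The logarithm of a maximum with 1 is nonnegative and so can replace the summand
    0.\<close>
  also have "\<dots> \<le> - ereal r + elog (ereal (real (card N)))
         + elog (max (ereal \<kappa> * L * D / ereal \<delta>) 1) + 2"
    by (intro add_mono elog_nonneg order_refl) simp
  finally show ?thesis by (simp only: E_def)
qed

end
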